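(* Let $K$ be an algebraically closed field, $S=K[y_0,\dots,y_n]$, $\mathfrak M=(y_0,\dots,y_n)$. Let $\mathfrak I\subset S$ be a homogeneous ideal with $\mathfrak I^{sat}\subsetneq\mathfrak M$, let $\mathcal B=\{f,\mathcal B_1\}$ be a standard basis of $\mathfrak I$ with $f\in\mathfrak I_d$, and let $\mathfrak H=(\mathcal B_1)S$. The following are equivalent: (i) $f$ is essential with respect to $\mathcal B$; (ii) there exists a set $\{L_1^*,\dots,L_n^*,N\}$ of linear forms generating $\mathfrak M$ such that (a) $N$ is regular both for $S/\mathfrak H^{sat}$ and for $S/\mathfrak I^{sat}$; (b) for all $t\in\mathbb N$, $fN^t\notin\mathfrak J$, where $\mathfrak J=(\mathcal B_1,L_1^*f,\dots,L_n^*f)$.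
   Context: For a homogeneous ideal $\mathfrak I$, $\mathfrak I_d$ is its degree-$d$ part and $\mathfrak I^{sat}=\{f\in S:\ f\,\mathfrak M^t\subseteq\mathfrak I\text{ for some }t\in\mathbb N\}$. A standard basis of $\mathfrak I$ is an ordered set of forms generating $\mathfrak I$ such that, for each $d$, its elements of degree $d$ define a $K$-basis of $\mathfrak I_d/(\mathfrak I_{d-1}S_1)$. An element $f$ of a standard basis $\mathcal B$ is inessential with respect to $\mathcal B$ if $f\in\mathfrak H^{sat}$, where $\mathfrak H$ is the ideal generated by $\mathcal B\setminus\{f\}$; otherwise $f$ is essential with respect to $\mathcal B$. A form is regular for $S/\mathfrak J$ if it is a nonzerodivisor on $S/\mathfrak J$. *)

theory Defs
  imports
    "HOL-Library.Poly_Mapping"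
    "HOL-Library.Set_Algebras"
    "HOL-Library.Cardinality"
    "HOL-Computational_Algebra.Polynomial"
begin

text \<open>
  The polynomial ring in the finitely many variables \<open>'n\<close> over \<open>'k\<close>: finitely supported maps
  from exponent vectors to coefficients, with the convolution product of \<open>Poly_Mapping\<close>.
\<close>

type_synonym ('n, 'k) mpoly = "('n \<Rightarrow>\<^sub>0 nat) \<Rightarrow>\<^sub>0 'k"

definition var :: "'n \<Rightarrow> ('n, 'k::comm_ring_1) mpoly" where
  "var i = Poly_Mapping.single (Poly_Mapping.single i 1) 1"

definition cmult :: "'k::comm_ring_1 \<Rightarrow> ('n, 'k) mpoly \<Rightarrow> ('n, 'k) mpoly" where
  "cmult c p = Poly_Mapping.single 0 c * p"

text \<open>
  Ideals are the submodules of a commutative ring over itself: \<open>ideal.subspace\<close> is the predicate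
  ``is an ideal'', \<open>ideal.span\<close> the generated ideal.
\<close>

global_interpretation ideal: module "(*) :: 'a::comm_ring_1 \<Rightarrow> 'a \<Rightarrow> 'a"
  by standard (simp_all add: algebra_simps)

global_interpretation lin: vector_space "cmult :: 'k::field \<Rightarrow> ('n, 'k) mpoly \<Rightarrow> ('n, 'k) mpoly"
  by standard
    (simp_all add: cmult_def distrib_left single_add distrib_right mult_single mult.assoc[symmetric])

definition ideal_prod :: "'a::comm_ring_1 set \<Rightarrow> 'a set \<Rightarrow> 'a set" where
  "ideal_prod I J = ideal.span {a * b | a b. a \<in> I \<and> b \<in> J}"

fun ideal_pow :: "'a::comm_ring_1 set \<Rightarrow> nat \<Rightarrow> 'a set" where
  "ideal_pow I 0 = UNIV"
| "ideal_pow I (Suc t) = ideal_prod (ideal_pow I t) I"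

text \<open>As usual, the zero polynomial is a form of every degree.\<close>

definition form :: "nat \<Rightarrow> ('n::finite, 'k::comm_ring_1) mpoly \<Rightarrow> bool" where
  "form d p \<longleftrightarrow> (\<forall>m\<in>Poly_Mapping.keys p. (\<Sum>i\<in>UNIV. Poly_Mapping.lookup m i) = d)"

definition homogeneous_ideal :: "('n::finite, 'k::comm_ring_1) mpoly set \<Rightarrow> bool" where
  "homogeneous_ideal I \<longleftrightarrow> (\<exists>G. (\<forall>g\<in>G. \<exists>d. form d g) \<and> I = ideal.span G)"

definition degree_part :: "('n::finite, 'k::comm_ring_1) mpoly set \<Rightarrow> nat \<Rightarrow> ('n, 'k) mpoly set" where
  "degree_part I d = {p \<in> I. form d p}"

definition irrelevant_ideal :: "('n::finite, 'k::comm_ring_1) mpoly set" where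
  "irrelevant_ideal = ideal.span (range var)"

definition saturation :: "('n::finite, 'k::comm_ring_1) mpoly set \<Rightarrow> ('n, 'k) mpoly set" where
  "saturation I = {f. \<exists>t. (\<lambda>g. f * g) ` ideal_pow irrelevant_ideal t \<subseteq> I}"

text \<open>
  The space \<open>I\<^sub>d\<^sub>-\<^sub>1 S\<^sub>1\<close> inside the degree-\<open>d\<close> part; it is zero for \<open>d = 0\<close>, where
  \<open>I\<close> has no part of degree \<open>d - 1\<close>.
\<close>

fun prev_part :: "('n::finite, 'k::field) mpoly set \<Rightarrow> nat \<Rightarrow> ('n, 'k) mpoly set" where
  "prev_part I 0 = {0}"
| "prev_part I (Suc d) = lin.span {p * l | p l. p \<in> degree_part I d \<and> l \<in> degree_part UNIV 1}"

text \<open>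
  The classes of the elements of \<open>B\<close> form a basis of the quotient space \<open>V / W\<close>, the class of
  \<open>v\<close> being the coset \<open>v +o W\<close>. Linear independence is that of the family
  \<open>(b +o W)\<close> indexed by \<open>b \<in> B\<close>, so distinct elements of \<open>B\<close> have distinct classes.
\<close>

definition basis_of_quotient ::
  "('n, 'k::field) mpoly set \<Rightarrow> ('n, 'k) mpoly set \<Rightarrow> ('n, 'k) mpoly set \<Rightarrow> bool" where
  "basis_of_quotient V W B \<longleftrightarrow>
     B \<subseteq> V \<and>
     (\<forall>T c. finite T \<longrightarrow> T \<subseteq> B \<longrightarrow> (\<Sum>b\<in>T. cmult (c b) b) +o W = 0 +o W \<longrightarrow> (\<forall>b\<in>T. c b = 0)) \<and>
     (\<forall>v\<in>V. \<exists>T c. finite T \<and> T \<subseteq> B \<and> v +o W = (\<Sum>b\<in>T. cmult (c b) b) +o W)"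

text \<open>
  A standard basis is usually presented as an ordered set; the defining conditions do not involve
  the order, so it is a plain set here.
\<close>

definition standard_basis :: "('n::finite, 'k::field) mpoly set \<Rightarrow> ('n, 'k) mpoly set \<Rightarrow> bool" where
  "standard_basis I B \<longleftrightarrow>
     (\<forall>b\<in>B. \<exists>d. form d b) \<and>
     ideal.span B = I \<and>
     (\<forall>d. basis_of_quotient (degree_part I d) (prev_part I d) {b \<in> B. form d b})"

definition inessential :: "('n::finite, 'k::field) mpoly set \<Rightarrow> ('n, 'k) mpoly \<Rightarrow> bool" where
  "inessential B f \<longleftrightarrow> f \<in> saturation (ideal.span (B - {f}))"

abbreviation essential :: "('n::finite, 'k::field) mpoly set \<Rightarrow> ('n, 'k) mpoly \<Rightarrow> bool" where
  "essential B f \<equiv> \<not> inessential B f"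

text \<open>\<open>N\<close> is a nonzerodivisor on the quotient by the ideal \<open>J\<close>.\<close>

definition regular_for_quotient :: "'a::comm_ring_1 \<Rightarrow> 'a set \<Rightarrow> bool" where
  "regular_for_quotient N J \<longleftrightarrow> (\<forall>g. (N * g) +o J = 0 +o J \<longrightarrow> g +o J = 0 +o J)"

end

theory Submission
  imports Defs
begin

text \<open>
  Write \<open>M\<close> for the irrelevant ideal and \<open>J\<close> for the ideal in (b). The element \<open>f\<close> is inessential if and
  only if the homogeneous ideal \<open>(H : f)\<close> contains a power of \<open>M\<close>. If it does, it contains a power of
  every linear form \<open>N\<close>, and some \<open>f N\<^sup>t\<close> lies in \<open>H\<close>, which is contained in \<open>J\<close>; so (ii) implies (i).

  Otherwise \<open>(H : f)\<close> has a zero \<open>P\<close> in projective space. Let \<open>N\<close> be a general linear form, so that it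
  does not vanish at \<open>P\<close>, and let \<open>L\<^sub>1, \<dots>, L\<^sub>n\<close> be linear forms cutting out \<open>P\<close>. If \<open>f N\<^sup>t\<close> lies in \<open>J\<close>,
  then \<open>N\<^sup>t\<close> lies in \<open>(H : f) + (L\<^sub>1, \<dots>, L\<^sub>n)\<close>; but this ideal vanishes at \<open>P\<close> and \<open>N\<^sup>t\<close> does not. This
  gives (b), and (a) holds for general \<open>N\<close> because \<open>M\<close> is not an associated prime of a saturated ideal.

  The point \<open>P\<close> is present only through its ideal \<open>Q\<close>, a homogeneous ideal containing \<open>(H : f)\<close> that is
  maximal among those that contain no power of \<open>M\<close> (\<open>graded_maximal_prime\<close>). The Nullstellensatz then
  takes the form that every linear form is congruent modulo \<open>Q\<close> to a scalar multiple of \<open>N\<close>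
  (\<open>linear_form_multiple_mod_maximal\<close>), which yields the \<open>L\<^sub>i\<close> (\<open>linear_generators_through_point\<close>).
  Both the existence of \<open>Q\<close> and the choice of \<open>N\<close> rest on the ascending chain condition
  (\<open>ideal_chain_stabilizes\<close>): an ideal has only finitely many maximal proper ideal quotients
  (\<open>finite_maximal_colons\<close>). They are prime, and for a saturated ideal each of them contains only
  finitely many members of a one-parameter family of linear forms (\<open>moment_forms_span\<close>).
\<close>

section \<open>Monomials and forms\<close>

(* This rule reassociates products in the direction opposite to mult.assoc. *)
declare ideal.scale_scale [simp del]

abbreviation mdeg :: "('n::finite \<Rightarrow>\<^sub>0 nat) \<Rightarrow> nat" where
  "mdeg m \<equiv> (\<Sum>i\<in>UNIV. Poly_Mapping.lookup m i)"

abbreviation mon :: "('n \<Rightarrow>\<^sub>0 nat) \<Rightarrow> ('n, 'k::comm_ring_1) mpoly" where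
  "mon m \<equiv> Poly_Mapping.single m 1"

abbreviation const :: "'k::comm_ring_1 \<Rightarrow> ('n, 'k) mpoly" where
  "const c \<equiv> Poly_Mapping.single 0 c"

lemma mpoly_as_sum:
  fixes p :: "('n, 'k::comm_ring_1) mpoly"
  shows "p = (\<Sum>m\<in>Poly_Mapping.keys p. Poly_Mapping.single m (Poly_Mapping.lookup p m))"
  by (rule poly_mapping_eqI)
     (simp add: lookup_sum lookup_single when_def in_keys_iff)

lemma mpoly_induct [case_names single add]:
  fixes p :: "('n, 'k::comm_ring_1) mpoly"
  assumes single: "\<And>m c. P (Poly_Mapping.single m c)"
    and add: "\<And>p q. P p \<Longrightarrow> P q \<Longrightarrow> P (p + q)"
  shows "P p"
proof -
  have "P (\<Sum>m\<in>A. Poly_Mapping.single m (Poly_Mapping.lookup p m))" if "finite A" for A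
    using that
  proof induction
    case empty
    show ?case using single[of 0 0] by simp
  next
    case (insert x F)
    then show ?case by (simp add: single add)
  qed
  from this[OF finite_keys[of p]] show ?thesis using mpoly_as_sum[of p] by simp
qed

lemma lookup_single_mult:
  fixes p :: "('n, 'k::comm_ring_1) mpoly"
  shows "Poly_Mapping.lookup (Poly_Mapping.single d c * p) (d + m) = c * Poly_Mapping.lookup p m"
proof (induction p rule: mpoly_induct)
  case (single m' c')
  show ?case by (simp add: mult_single lookup_single when_def)
next
  case (add p q)
  then show ?case by (simp add: algebra_simps lookup_add)
qed

lemma keys_single_mult:
  fixes p :: "('n, 'k::comm_ring_1) mpoly"
  assumes "x \<in> Poly_Mapping.keys (Poly_Mapping.single d c * p)"
  obtains m where "m \<in> Poly_Mapping.keys p" "x = d + m"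
  using keys_mult[of "Poly_Mapping.single d c" p] assms by (auto split: if_splits)

lemma mdeg_add: "mdeg (a + b) = mdeg a + mdeg b"
  by (simp add: lookup_add sum.distrib)

lemma form_single: "form (mdeg m) (Poly_Mapping.single m c)"
  by (simp add: form_def)

lemma form_0: "form d 0"
  by (simp add: form_def)

lemma form_add: "form d p \<Longrightarrow> form d q \<Longrightarrow> form d (p + q)"
  using keys_add[of p q] by (auto simp: form_def)

lemma form_uminus: "form d p \<Longrightarrow> form d (- p)"
  by (auto simp: form_def)

lemma form_diff: "form d p \<Longrightarrow> form d q \<Longrightarrow> form d (p - q)"
  using form_add[of d p "- q"] form_uminus[of d q] by simp

lemma form_sum: "(\<And>x. x \<in> A \<Longrightarrow> form d (g x)) \<Longrightarrow> form d (sum g A)"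
  by (induction A rule: infinite_finite_induct) (simp_all add: form_0 form_add)

lemma form_mult:
  assumes "form d p" "form e q"
  shows "form (d + e) (p * q)"
  unfolding form_def
proof
  fix x assume "x \<in> Poly_Mapping.keys (p * q)"
  then obtain a b where "a \<in> Poly_Mapping.keys p" "b \<in> Poly_Mapping.keys q" "x = a + b"
    using keys_mult[of p q] by blast
  then show "mdeg x = d + e"
    using assms by (simp add: form_def mdeg_add)
qed

lemma form_const: "form 0 (const c)"
  using form_single[of 0 c] by simp

lemma form_const_mult: "form d p \<Longrightarrow> form d (const c * p)"
  using form_mult[OF form_const[of c], of d p] by simp

lemma form_1: "form 0 1"
  using form_const[of 1] by simp

lemma form_power: "form d p \<Longrightarrow> form (k * d) (p ^ k)"
  by (induction k) (simp_all add: form_1 form_mult)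

lemma mdeg_unit: "mdeg (Poly_Mapping.single i 1) = 1"
  by (simp add: lookup_single when_def)

lemma form_var: "form 1 (var i)"
  unfolding var_def using form_single[of "Poly_Mapping.single i 1" 1] by (simp only: mdeg_unit)

section \<open>Dickson's lemma and ascending chains of ideals\<close>

lemma nat_seq_incseq_subseq:
  fixes s :: "nat \<Rightarrow> nat"
  obtains r where "strict_mono r" "incseq (\<lambda>k. s (r k))"
proof -
  obtain r where r: "strict_mono r" "monoseq (\<lambda>k. s (r k))"
    using seq_monosub[of s] by (auto simp: o_def)
  show thesis
  proof (cases "incseq (\<lambda>k. s (r k))")
    case True
    with r that show thesis by blast
  next
    case False
    with r have dec: "decseq (\<lambda>k. s (r k))"
      by (auto simp: monoseq_iff)
    define v where "v = (LEAST v. v \<in> range (\<lambda>k. s (r k)))"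
    have "v \<in> range (\<lambda>k. s (r k))"
      unfolding v_def by (rule LeastI[of _ "s (r 0)"]) auto
    then obtain K where K: "v = s (r K)" by auto
    have ge: "v \<le> s (r k)" for k
      unfolding v_def by (rule Least_le) auto
    have "s (r (k + K)) = v" for k
      using ge[of "k + K"] dec K by (simp add: decseq_def antisym)
    moreover have "strict_mono (\<lambda>k. r (k + K))"
      using r(1) by (simp add: strict_mono_def)
    ultimately show thesis
      using that[of "\<lambda>k. r (k + K)"] by (simp add: incseq_def)
  qed
qed

text \<open>
  Passing to a subsequence makes one coordinate after the other nondecreasing, so that all finitely
  many coordinates are nondecreasing along a single subsequence; its first two members are as wanted.
\<close>

lemma Dickson:
  fixes s :: "nat \<Rightarrow> ('n::finite \<Rightarrow>\<^sub>0 nat)"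
  obtains i j where "i < j" "\<And>x. Poly_Mapping.lookup (s i) x \<le> Poly_Mapping.lookup (s j) x"
proof -
  have "\<exists>r. strict_mono r \<and> (\<forall>x\<in>A. incseq (\<lambda>k. Poly_Mapping.lookup (s (r k)) x))"
    if "finite A" for A
    using that
  proof induction
    case empty
    show ?case by (intro exI[of _ id]) (simp add: strict_mono_def)
  next
    case (insert a A)
    then obtain r where r: "strict_mono r"
      "\<And>x. x \<in> A \<Longrightarrow> incseq (\<lambda>k. Poly_Mapping.lookup (s (r k)) x)" by blast
    obtain r' where r': "strict_mono r'" "incseq (\<lambda>k. Poly_Mapping.lookup (s (r (r' k))) a)"
      using nat_seq_incseq_subseq[of "\<lambda>k. Poly_Mapping.lookup (s (r k)) a"] .
    have "incseq (\<lambda>k. Poly_Mapping.lookup (s (r (r' k))) x)" if "x \<in> A" for x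
      using r(2)[OF that] strict_mono_mono[OF r'(1)] by (simp add: mono_def)
    with r r' show ?case
      by (intro exI[of _ "\<lambda>k. r (r' k)"]) (auto simp: strict_mono_def)
  qed
  from this[of UNIV] obtain r where r: "strict_mono r"
      "\<And>x. incseq (\<lambda>k. Poly_Mapping.lookup (s (r k)) x)" by auto
  show thesis
  proof (rule that[of "r 0" "r 1"])
    show "r 0 < r 1" using r(1) by (simp add: strict_mono_def)
    show "Poly_Mapping.lookup (s (r 0)) x \<le> Poly_Mapping.lookup (s (r 1)) x" for x
      using r(2)[of x] by (simp add: incseq_def)
  qed
qed

text \<open>
  The lexicographic order for some enumeration of the variables. A monomial order is needed that is
  total, compatible with products and well-founded; as a lexicographic product of measures it is
  well-founded for free.
\<close>

definition lex_less :: "('n::finite \<Rightarrow>\<^sub>0 nat) rel" where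
  "lex_less = measures (map (\<lambda>x m. Poly_Mapping.lookup m x) (SOME xs. set xs = UNIV))"

lemma wf_lex_less: "wf lex_less"
  by (simp add: lex_less_def)

lemma measures_trans: "(a, b) \<in> measures fs \<Longrightarrow> (b, c) \<in> measures fs \<Longrightarrow> (a, c) \<in> measures fs"
  by (induction fs) auto

lemma measures_total: "(a, b) \<in> measures fs \<or> (b, a) \<in> measures fs \<or> (\<forall>f\<in>set fs. f a = f b)"
  by (induction fs) auto

lemma lex_less_trans: "(a, b) \<in> lex_less \<Longrightarrow> (b, c) \<in> lex_less \<Longrightarrow> (a, c) \<in> lex_less"
  unfolding lex_less_def by (rule measures_trans)

lemma lex_less_total:
  fixes a b :: "'n::finite \<Rightarrow>\<^sub>0 nat"
  assumes "a \<noteq> b"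
  shows "(a, b) \<in> lex_less \<or> (b, a) \<in> lex_less"
proof -
  define xs where "xs = (SOME xs. set xs = (UNIV :: 'n set))"
  have "\<exists>xs. set xs = (UNIV :: 'n set)" by (rule finite_list) simp
  then have "set xs = UNIV" unfolding xs_def by (rule someI_ex)
  moreover obtain x where "Poly_Mapping.lookup a x \<noteq> Poly_Mapping.lookup b x"
    using assms by (meson poly_mapping_eqI)
  ultimately show ?thesis
    using measures_total[of a b "map (\<lambda>x m. Poly_Mapping.lookup m x) xs"]
    unfolding lex_less_def xs_def[symmetric] by auto
qed

lemma lex_less_add: "(a, b) \<in> lex_less \<Longrightarrow> (d + a, d + b) \<in> lex_less"
proof -
  have "(a, b) \<in> measures (map (\<lambda>x m. Poly_Mapping.lookup m x) xs) \<Longrightarrow>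
    (d + a, d + b) \<in> measures (map (\<lambda>x m. Poly_Mapping.lookup m x) xs)" for xs
    by (induction xs) (auto simp: lookup_add)
  then show "(a, b) \<in> lex_less \<Longrightarrow> (d + a, d + b) \<in> lex_less"
    by (simp add: lex_less_def)
qed

text \<open>
  The leading exponent, as a relation because the zero polynomial has none.
\<close>

definition lead :: "('n::finite, 'k::comm_ring_1) mpoly \<Rightarrow> ('n \<Rightarrow>\<^sub>0 nat) \<Rightarrow> bool" where
  "lead p m \<longleftrightarrow> m \<in> Poly_Mapping.keys p \<and> (\<forall>m'\<in>Poly_Mapping.keys p. m' \<noteq> m \<longrightarrow> (m', m) \<in> lex_less)"

lemma lead_exists:
  assumes "p \<noteq> 0"
  obtains m where "lead p m"
proof -
  have "\<exists>m\<in>A. \<forall>m'\<in>A. m' \<noteq> m \<longrightarrow> (m', m) \<in> lex_less"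
    if "finite A" "A \<noteq> {}" for A :: "('a \<Rightarrow>\<^sub>0 nat) set"
    using that
  proof (induction rule: finite_ne_induct)
    case (insert x F)
    then obtain m where m: "m \<in> F" "\<And>m'. m' \<in> F \<Longrightarrow> m' \<noteq> m \<Longrightarrow> (m', m) \<in> lex_less"
      by blast
    show ?case
    proof (cases "(x, m) \<in> lex_less")
      case True
      with m show ?thesis by auto
    next
      case False
      with m insert have "(m, x) \<in> lex_less"
        using lex_less_total[of x m] by auto
      then have "(m', x) \<in> lex_less" if "m' \<in> F" for m'
        using m(2)[OF that] lex_less_trans[of m' m x] by (cases "m' = m") auto
      then show ?thesis by blast
    qed
  qed auto
  from this[of "Poly_Mapping.keys p"] assms obtain m where "lead p m"
    by (auto simp: lead_def)
  with that show thesis by blast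
qed

text \<open>
  Hilbert's basis theorem. If each inclusion were strict, choose \<open>h k\<close> in \<open>J (Suc k) - J k\<close> with the
  smallest possible leading exponent \<open>m k\<close>. By Dickson's lemma \<open>m i\<close> divides \<open>m j\<close> for some \<open>i < j\<close>.
  Subtracting a monomial multiple of \<open>h i\<close>, which lies in \<open>J j\<close>, cancels the leading term of \<open>h j\<close>
  without leaving \<open>J (Suc j) - J j\<close>, against the choice of \<open>h j\<close>.
\<close>

lemma ideal_chain_stabilizes:
  fixes J :: "nat \<Rightarrow> ('n::finite, 'k::field) mpoly set"
  assumes ideal: "\<And>k. ideal.subspace (J k)" and chain: "\<And>k. J k \<subseteq> J (Suc k)"
  obtains k where "J (Suc k) = J k"
proof -
  have False if strict: "\<And>k. J (Suc k) \<noteq> J k"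
  proof -
    define minimal where "minimal k h m \<longleftrightarrow> h \<in> J (Suc k) - J k \<and> lead h m \<and>
        (\<forall>h' m'. h' \<in> J (Suc k) - J k \<longrightarrow> lead h' m' \<longrightarrow> (m', m) \<notin> lex_less)" for k h m
    have "\<exists>h m. minimal k h m" for k
    proof -
      define A where "A = {m. \<exists>h \<in> J (Suc k) - J k. lead h m}"
      obtain h where h: "h \<in> J (Suc k) - J k" using strict chain by blast
      then have "h \<noteq> 0" using ideal.subspace_0[OF ideal] by auto
      then obtain m where "lead h m" using lead_exists by blast
      with h have "m \<in> A" by (auto simp: A_def)
      then obtain m0 where "m0 \<in> A" "\<And>m'. (m', m0) \<in> lex_less \<Longrightarrow> m' \<notin> A"
        using wfE_min[OF wf_lex_less, of m A] by blast
      then show ?thesis unfolding A_def minimal_def by blast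
    qed
    then obtain h m where hm: "\<And>k. minimal k (h k) (m k)" by metis
    then have h: "\<And>k. h k \<in> J (Suc k)" "\<And>k. h k \<notin> J k" "\<And>k. lead (h k) (m k)"
      by (auto simp: minimal_def)
    have min: "(m', m k) \<notin> lex_less" if "h' \<in> J (Suc k)" "h' \<notin> J k" "lead h' m'" for k h' m'
      using hm[of k] that by (simp add: minimal_def)
    obtain i j where ij: "i < j"
      and le: "\<And>x. Poly_Mapping.lookup (m i) x \<le> Poly_Mapping.lookup (m j) x"
      using Dickson[of m] by blast
    define d where "d = m j - m i"
    have d: "m j = d + m i"
      using le by (intro poly_mapping_eqI) (simp add: d_def lookup_add lookup_minus)
    define c where "c = Poly_Mapping.lookup (h j) (m j) / Poly_Mapping.lookup (h i) (m i)"
    have ci: "Poly_Mapping.lookup (h i) (m i) \<noteq> 0"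
      using h(3)[of i] by (simp add: lead_def in_keys_iff)
    define q where "q = Poly_Mapping.single d c * h i"
    have "J (Suc i) \<subseteq> J j" using ij chain by (simp add: lift_Suc_mono_le Suc_leI)
    then have q: "q \<in> J j" unfolding q_def using h(1) ideal.subspace_scale[OF ideal] by blast
    define h' where "h' = h j - q"
    have h'1: "h' \<in> J (Suc j)"
      unfolding h'_def using q chain h(1) ideal.subspace_diff[OF ideal] by blast
    have h'2: "h' \<notin> J j"
    proof
      assume "h' \<in> J j"
      then have "h' + q \<in> J j" using q ideal.subspace_add[OF ideal] by blast
      then show False using h(2) by (simp add: h'_def)
    qed
    then have "h' \<noteq> 0" using ideal.subspace_0[OF ideal] by auto
    then obtain m' where m': "lead h' m'" using lead_exists by blast
    have "Poly_Mapping.lookup h' (m j) = 0"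
      using ci unfolding h'_def q_def lookup_minus by (subst (2) d) (simp add: lookup_single_mult c_def)
    with m' have ne: "m' \<noteq> m j" by (auto simp: lead_def)
    have "m' \<in> Poly_Mapping.keys h'" using m' by (simp add: lead_def)
    then consider "m' \<in> Poly_Mapping.keys (h j)" | "m' \<in> Poly_Mapping.keys q"
      using keys_diff[of "h j" q] unfolding h'_def by (auto simp: in_keys_iff lookup_minus)
    then have "(m', m j) \<in> lex_less"
    proof cases
      case 1
      then show ?thesis using h(3)[of j] ne by (auto simp: lead_def)
    next
      case 2
      then obtain b where b: "b \<in> Poly_Mapping.keys (h i)" "m' = d + b"
        unfolding q_def by (rule keys_single_mult)
      with ne d have "b \<noteq> m i" by auto
      with b h(3)[of i] have "(b, m i) \<in> lex_less" by (auto simp: lead_def)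
      then show ?thesis unfolding b d by (rule lex_less_add)
    qed
    with min[OF h'1 h'2 m'] show False by simp
  qed
  with that show thesis by blast
qed

section \<open>Ideal quotients and saturation\<close>

lemma ideal_mult: "ideal.subspace J \<Longrightarrow> p \<in> J \<Longrightarrow> a * p \<in> J"
  "ideal.subspace J \<Longrightarrow> p \<in> J \<Longrightarrow> p * a \<in> J"
  using ideal.subspace_scale[of J p a] by (simp_all add: mult.commute)

lemma mdeg_eq_0D: "mdeg m = 0 \<Longrightarrow> m = 0"
  by (intro poly_mapping_eqI) simp

lemma exponent_split:
  assumes "t \<le> mdeg m"
  obtains a b where "m = a + b" "mdeg a = t"
proof -
  have "\<exists>a b. m = a + b \<and> mdeg a = t" using assms
  proof (induction t)
    case 0
    show ?case by (intro exI[of _ 0] exI[of _ m]) simp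
  next
    case (Suc t)
    then obtain a b where ab: "m = a + b" "mdeg a = t" by auto
    with Suc.prems have "mdeg b \<noteq> 0" unfolding ab(1) mdeg_add by linarith
    then obtain i where i: "Poly_Mapping.lookup b i \<noteq> 0" by (metis sum.neutral)
    have "b = Poly_Mapping.single i 1 + (b - Poly_Mapping.single i 1)"
      using i by (intro poly_mapping_eqI) (auto simp: lookup_add lookup_minus lookup_single when_def)
    then have "m = (a + Poly_Mapping.single i 1) + (b - Poly_Mapping.single i 1)"
      using ab by (metis add.assoc)
    moreover have "mdeg (a + Poly_Mapping.single i 1) = Suc t"
      using ab(2) mdeg_unit[of i] by (simp only: mdeg_add)
    ultimately show ?case by blast
  qed
  with that show thesis by blast
qed

lemma mon_add: "(mon (a + b) :: ('n, 'k::comm_ring_1) mpoly) = mon a * mon b"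
  by (simp add: mult_single)

lemma mon_SucE:
  assumes "mdeg m = Suc t"
  obtains a i where "(mon m :: ('n::finite, 'k::comm_ring_1) mpoly) = mon a * var i" "mdeg a = t"
proof -
  obtain b a where ab: "m = b + a" "mdeg b = 1" using exponent_split[of 1 m] assms by auto
  then obtain i where i: "Poly_Mapping.lookup b i \<noteq> 0" by (metis sum.neutral zero_neq_one)
  have b: "b = Poly_Mapping.single i 1 + (b - Poly_Mapping.single i 1)"
    using i by (intro poly_mapping_eqI) (auto simp: lookup_add lookup_minus lookup_single when_def)
  then have "mdeg b = mdeg (Poly_Mapping.single i 1) + mdeg (b - Poly_Mapping.single i 1)"
    by (metis mdeg_add)
  with ab(2) have "mdeg (b - Poly_Mapping.single i 1) = 0" unfolding mdeg_unit by linarith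
  with b have "b = Poly_Mapping.single i 1" using mdeg_eq_0D by fastforce
  moreover have "mdeg a = t" using ab assms by (simp only: mdeg_add)
  ultimately show thesis
    using that[of a i] ab by (simp add: var_def mult_single add.commute)
qed

text \<open>
  For an ideal \<open>J\<close>: some power of the irrelevant ideal lies in \<open>J\<close>. For homogeneous \<open>J\<close> over an
  algebraically closed field this says that \<open>J\<close> has no zero in projective space.
\<close>

definition contains_power :: "('n::finite, 'k::comm_ring_1) mpoly set \<Rightarrow> bool" where
  "contains_power J \<longleftrightarrow> (\<exists>t. \<forall>m. mdeg m = t \<longrightarrow> mon m \<in> J)"

lemma form_in_ideal:
  assumes J: "ideal.subspace J" "\<And>m. mdeg m = t \<Longrightarrow> mon m \<in> J" and p: "form e p" "t \<le> e"
  shows "p \<in> J"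
proof -
  have "Poly_Mapping.single m (Poly_Mapping.lookup p m) \<in> J" if "m \<in> Poly_Mapping.keys p" for m
  proof -
    have "t \<le> mdeg m" using p that by (simp add: form_def)
    then obtain a b where ab: "m = a + b" "mdeg a = t" by (rule exponent_split)
    have "Poly_Mapping.single m (Poly_Mapping.lookup p m) = Poly_Mapping.single b (Poly_Mapping.lookup p m) * mon a"
      using ab by (simp add: mult_single add.commute)
    then show ?thesis using J(2)[OF ab(2)] ideal_mult(1)[OF J(1)] by simp
  qed
  then show ?thesis
    by (subst mpoly_as_sum) (rule ideal.subspace_sum[OF J(1)])
qed

lemma contains_power_eventually:
  assumes "ideal.subspace J" "contains_power J"
  obtains t where "\<And>e p. t \<le> e \<Longrightarrow> form e p \<Longrightarrow> p \<in> J"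
proof -
  from assms(2) obtain t where "\<And>m. mdeg m = t \<Longrightarrow> mon m \<in> J" by (auto simp: contains_power_def)
  with that form_in_ideal[OF assms(1)] show thesis by metis
qed

lemma contains_powerI: "(\<And>m. mdeg m = t \<Longrightarrow> mon m \<in> J) \<Longrightarrow> contains_power J"
  by (auto simp: contains_power_def)

lemma form_mon: "mdeg m = t \<Longrightarrow> form t (mon m)"
  using form_single by blast

definition colon :: "'a::comm_ring_1 set \<Rightarrow> 'a \<Rightarrow> 'a set" where
  "colon J g = {p. p * g \<in> J}"

lemma in_colon [simp]: "p \<in> colon J g \<longleftrightarrow> p * g \<in> J"
  by (simp add: colon_def)

lemma ideal_colon: "ideal.subspace J \<Longrightarrow> ideal.subspace (colon J g)"
  by (rule ideal.subspaceI)
    (simp_all add: ideal.subspace_0 distrib_right ideal.subspace_add mult.assoc ideal.subspace_scale)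

lemma ideal_pow_irrelevant:
  "ideal_pow (irrelevant_ideal :: ('n::finite, 'k::comm_ring_1) mpoly set) t
    = ideal.span {mon m | m. mdeg m = t}"
proof (induction t)
  case 0
  have "(1 :: ('n, 'k) mpoly) \<in> ideal.span {mon m | m. mdeg m = 0}"
    by (rule ideal.span_base) (auto intro!: exI[of _ 0])
  then have "p \<in> ideal.span {mon m | m. mdeg m = 0}" for p :: "('n, 'k) mpoly"
    using ideal.span_scale[of 1 _ p] by simp
  then show ?case by auto
next
  case (Suc t)
  let ?M = "\<lambda>t. {mon m | m. mdeg m = t} :: ('n, 'k) mpoly set"
  show ?case
  proof
    have "a * b \<in> ideal.span (?M (Suc t))"
      if a: "a \<in> ideal.span (?M t)" and b: "b \<in> irrelevant_ideal" for a b
    proof -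
      have gen: "mon m * var i \<in> ideal.span (?M (Suc t))" if "mdeg m = t" for m :: "'n \<Rightarrow>\<^sub>0 nat" and i
      proof (rule ideal.span_base, clarify, intro exI conjI)
        show "mon m * var i = mon (m + Poly_Mapping.single i 1)"
          by (simp add: var_def mult_single)
        show "mdeg (m + Poly_Mapping.single i 1) = Suc t"
          using that mdeg_unit[of i] by (simp only: mdeg_add)
      qed
      have "ideal.span (?M t) \<subseteq> colon (ideal.span (?M (Suc t))) (var i)" for i
        using gen by (intro ideal.span_minimal ideal_colon ideal.subspace_span) auto
      then have "range var \<subseteq> colon (ideal.span (?M (Suc t))) a"
        using a by (force simp: mult.commute)
      then have "irrelevant_ideal \<subseteq> colon (ideal.span (?M (Suc t))) a"
        unfolding irrelevant_ideal_def
        by (intro ideal.span_minimal ideal_colon ideal.subspace_span)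
      with b show ?thesis by (auto simp: mult.commute)
    qed
    then show "ideal_pow irrelevant_ideal (Suc t) \<subseteq> ideal.span (?M (Suc t))"
      unfolding ideal_pow.simps ideal_prod_def Suc
      by (intro ideal.span_minimal ideal.subspace_span) blast
    have "(mon m :: ('n, 'k) mpoly) \<in> ideal_pow irrelevant_ideal (Suc t)" if m: "mdeg m = Suc t" for m :: "'n \<Rightarrow>\<^sub>0 nat"
    proof -
      obtain a i where ai: "(mon m :: ('n, 'k) mpoly) = mon a * var i" "mdeg a = t"
        using mon_SucE[OF m] .
      have "(mon a :: ('n, 'k) mpoly) \<in> ideal_pow irrelevant_ideal t"
        unfolding Suc using ai by (intro ideal.span_base) auto
      moreover have "(var i :: ('n, 'k) mpoly) \<in> irrelevant_ideal"
        unfolding irrelevant_ideal_def by (intro ideal.span_base) auto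
      ultimately show ?thesis
        unfolding ideal_pow.simps ideal_prod_def ai(1) by (intro ideal.span_base) blast
    qed
    then show "ideal.span (?M (Suc t)) \<subseteq> ideal_pow irrelevant_ideal (Suc t)"
      by (intro ideal.span_minimal) (auto simp: ideal_prod_def)
  qed
qed

lemma saturation_iff:
  assumes "ideal.subspace J"
  shows "f \<in> saturation J \<longleftrightarrow> contains_power (colon J f)"
proof -
  have "(\<lambda>g. f * g) ` ideal_pow irrelevant_ideal t \<subseteq> J \<longleftrightarrow> (\<forall>m. mdeg m = t \<longrightarrow> mon m \<in> colon J f)" for t
  proof -
    have "(\<lambda>g. f * g) ` ideal_pow irrelevant_ideal t \<subseteq> J \<longleftrightarrow>
        ideal_pow irrelevant_ideal t \<subseteq> colon J f"
    proof -
      have comm: "f * g \<in> J \<longleftrightarrow> g \<in> colon J f" for g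
        unfolding in_colon by (subst mult.commute) (rule refl)
      show ?thesis unfolding image_subset_iff comm by blast
    qed
    also have "\<dots> \<longleftrightarrow> {mon m | m. mdeg m = t} \<subseteq> colon J f"
      unfolding ideal_pow_irrelevant
      by (intro iffI ideal.span_minimal[OF _ ideal_colon[OF assms]])
        (erule subset_trans[OF ideal.span_superset])
    finally show ?thesis by auto
  qed
  then show ?thesis unfolding saturation_def contains_power_def by simp
qed

lemma ideal_saturation:
  assumes J: "ideal.subspace J"
  shows "ideal.subspace (saturation J)"
proof (rule ideal.subspaceI)
  show "0 \<in> saturation J"
    by (simp add: saturation_iff[OF J] contains_power_def ideal.subspace_0[OF J])
next
  fix f g assume "f \<in> saturation J" "g \<in> saturation J"
  then have "contains_power (colon J f)" "contains_power (colon J g)"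
    by (simp_all add: saturation_iff[OF J])
  then obtain s t where s: "\<And>e p. s \<le> e \<Longrightarrow> form e p \<Longrightarrow> p \<in> colon J f"
    and t: "\<And>e p. t \<le> e \<Longrightarrow> form e p \<Longrightarrow> p \<in> colon J g"
    using contains_power_eventually[OF ideal_colon[OF J]] by metis
  have "mon m \<in> colon J (f + g)" if "mdeg m = s + t" for m
    using s[OF _ form_mon[OF that]] t[OF _ form_mon[OF that]]
    by (simp add: distrib_left ideal.subspace_add[OF J])
  then show "f + g \<in> saturation J"
    unfolding saturation_iff[OF J] by (rule contains_powerI)
next
  fix c f assume "f \<in> saturation J"
  moreover have "colon J f \<subseteq> colon J (c * f)"
    using ideal_mult(1)[OF J] by (auto simp: mult.left_commute[of _ c])
  ultimately show "c * f \<in> saturation J"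
    unfolding saturation_iff[OF J] contains_power_def by blast
qed

text \<open>
  A uniform exponent for the finitely many variables makes \<open>g\<close> times every monomial of the next degree
  fall into \<open>J\<close>. This is where saturation excludes the irrelevant ideal as an associated prime.
\<close>

lemma saturation_saturated:
  assumes J: "ideal.subspace J" and g: "\<And>i. var i * g \<in> saturation J"
  shows "g \<in> saturation J"
proof -
  have "\<exists>t. \<forall>m. mdeg m = t \<longrightarrow> mon m * var i * g \<in> J" for i
    using g[of i] by (simp add: saturation_iff[OF J] contains_power_def mult.assoc)
  then obtain t where t: "\<And>i m. mdeg m = t i \<Longrightarrow> mon m \<in> colon J (var i * g)"
    by (metis in_colon mult.assoc)
  define s where "s = (\<Sum>i\<in>UNIV. t i)"
  have "mon m \<in> colon J g" if m: "mdeg m = Suc s" for m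
  proof -
    obtain a i where ai: "(mon m :: ('a, 'b) mpoly) = mon a * var i" "mdeg a = s" using mon_SucE[OF m] .
    have "t i \<le> s" unfolding s_def by (rule member_le_sum) auto
    then have "mon a \<in> colon J (var i * g)"
      using form_in_ideal[OF ideal_colon[OF J] t form_mon[OF ai(2)]] by blast
    then show ?thesis using ai by (simp add: mult.assoc)
  qed
  then show ?thesis unfolding saturation_iff[OF J] by (rule contains_powerI)
qed

lemma regular_for_quotient_iff:
  assumes "ideal.subspace J"
  shows "regular_for_quotient N J \<longleftrightarrow> (\<forall>g. N * g \<in> J \<longrightarrow> g \<in> J)"
proof -
  have "x +o J = 0 +o J \<longleftrightarrow> x \<in> J" for x
  proof
    assume "x +o J = 0 +o J"
    moreover have "x \<in> x +o J" using ideal.subspace_0[OF assms] by (auto simp: elt_set_plus_def)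
    ultimately show "x \<in> J" by simp
  next
    assume x: "x \<in> J"
    have "y \<in> x +o J \<longleftrightarrow> y \<in> J" for y
    proof
      assume "y \<in> J"
      then have "y = x + (y - x)" "y - x \<in> J" using x ideal.subspace_diff[OF assms] by auto
      then show "y \<in> x +o J" unfolding elt_set_plus_def by blast
    qed (auto simp: elt_set_plus_def intro: x ideal.subspace_add[OF assms])
    then show "x +o J = 0 +o J" by auto
  qed
  then show ?thesis unfolding regular_for_quotient_def by simp
qed

section \<open>Homogeneous components\<close>

definition hcomp :: "nat \<Rightarrow> ('n::finite, 'k::comm_ring_1) mpoly \<Rightarrow> ('n, 'k) mpoly" where
  "hcomp e p = (\<Sum>m | m \<in> Poly_Mapping.keys p \<and> mdeg m = e. Poly_Mapping.single m (Poly_Mapping.lookup p m))"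

lemma lookup_hcomp: "Poly_Mapping.lookup (hcomp e p) m = (Poly_Mapping.lookup p m when mdeg m = e)"
  by (auto simp: hcomp_def lookup_sum lookup_single when_def in_keys_iff)

lemma hcomp_add: "hcomp e (p + q) = hcomp e p + hcomp e q"
  by (rule poly_mapping_eqI) (simp add: lookup_hcomp lookup_add when_add_distrib)

lemma form_hcomp: "form e (hcomp e p)"
  by (auto simp: form_def in_keys_iff lookup_hcomp)

lemma hcomp_form: "form d p \<Longrightarrow> hcomp e p = (if e = d then p else 0)"
  by (rule poly_mapping_eqI) (auto simp: lookup_hcomp form_def in_keys_iff when_def)

lemma hcomp_mult_form:
  assumes a: "form d a"
  shows "hcomp e (p * a) = (if d \<le> e then hcomp (e - d) p * a else 0)"
proof (induction p rule: mpoly_induct)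
  case (single m c)
  have "hcomp e (Poly_Mapping.single m c * a) = (if e = mdeg m + d then Poly_Mapping.single m c * a else 0)"
    by (rule hcomp_form[OF form_mult[OF form_single a]])
  moreover have "hcomp (e - d) (Poly_Mapping.single m c) = (if e - d = mdeg m then Poly_Mapping.single m c else 0)"
    by (rule hcomp_form[OF form_single])
  ultimately show ?case by auto
next
  case (add p q)
  then show ?case by (simp add: distrib_right hcomp_add)
qed

text \<open>
  Homogeneity of an ideal in terms of its elements instead of its generators: in this form it
  visibly passes to ideal quotients by forms.
\<close>

definition graded :: "('n::finite, 'k::comm_ring_1) mpoly set \<Rightarrow> bool" where
  "graded J \<longleftrightarrow> (\<forall>p\<in>J. \<forall>e. hcomp e p \<in> J)"

lemma hcomp_0: "hcomp e 0 = 0"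
  by (simp add: hcomp_def)

lemma graded_span:
  assumes "\<And>g c e. g \<in> G \<Longrightarrow> hcomp e (c * g) \<in> ideal.span G"
  shows "graded (ideal.span G)"
  unfolding graded_def
proof
  fix p assume "p \<in> ideal.span G"
  then show "\<forall>e. hcomp e p \<in> ideal.span G"
    by (induction rule: ideal.span_induct_alt)
      (auto simp: hcomp_add hcomp_0 ideal.span_zero intro!: ideal.span_add assms)
qed

lemma hcomp_mult_form_in_span:
  assumes "g \<in> G" "form d g"
  shows "hcomp e (c * g) \<in> ideal.span G"
  using assms ideal.span_scale[OF ideal.span_base[OF assms(1)]]
  by (simp add: hcomp_mult_form ideal.span_zero)

lemma graded_span_forms: "(\<And>g. g \<in> G \<Longrightarrow> \<exists>d. form d g) \<Longrightarrow> graded (ideal.span G)"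
  by (rule graded_span) (use hcomp_mult_form_in_span in blast)

lemma graded_span_insert:
  assumes "ideal.subspace J" "graded J" "form d a"
  shows "graded (ideal.span (insert a J))"
proof (rule graded_span)
  fix g c e assume "g \<in> insert a J"
  then consider "g = a" | "g \<in> J" by blast
  then show "hcomp e (c * g) \<in> ideal.span (insert a J)"
  proof cases
    case 1
    then show ?thesis using assms(3) by (intro hcomp_mult_form_in_span) auto
  next
    case 2
    then have "hcomp e (c * g) \<in> J" using assms ideal_mult(1) by (auto simp: graded_def)
    then show ?thesis by (intro ideal.span_base) simp
  qed
qed

lemma graded_colon:
  assumes "graded J" "form d f"
  shows "graded (colon J f)"
  unfolding graded_def
proof (intro ballI allI)
  fix p e assume "p \<in> colon J f"
  then have "hcomp (e + d) (p * f) \<in> J" using assms(1) by (simp add: graded_def)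
  then show "hcomp e p \<in> colon J f" by (simp add: hcomp_mult_form[OF assms(2)])
qed

section \<open>General linear forms are nonzerodivisors\<close>

lemma ideal_family_maximal:
  fixes F :: "('n::finite, 'k::field) mpoly set set"
  assumes ideal: "\<And>J. J \<in> F \<Longrightarrow> ideal.subspace J" and ne: "J0 \<in> F"
  obtains M where "M \<in> F" "\<And>J. J \<in> F \<Longrightarrow> M \<subseteq> J \<Longrightarrow> J = M"
proof (rule ccontr)
  assume "\<not> thesis"
  with that have step: "\<exists>J. J \<in> F \<and> M \<subset> J" if "M \<in> F" for M
    using \<open>M \<in> F\<close> by blast
  have "\<exists>f. \<forall>n. f n \<in> F \<and> f n \<subset> f (Suc n)"
    by (rule dependent_nat_choice) (use ne step in auto)
  then obtain J where J: "\<And>n. J n \<in> F" "\<And>n. J n \<subset> J (Suc n)" by blast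
  obtain k where "J (Suc k) = J k"
    using ideal_chain_stabilizes[of J] ideal J by blast
  with J(2)[of k] show False by blast
qed

text \<open>
  The ideals \<open>(J : g) \<noteq> (1)\<close> that are maximal among all ideals of this kind. They are the maximal
  associated primes of \<open>J\<close>, and their union is the set of zero divisors modulo \<open>J\<close>.
\<close>

definition maximal_colons :: "'a::comm_ring_1 set \<Rightarrow> 'a set set" where
  "maximal_colons J = {colon J g | g. g \<notin> J \<and> (\<forall>h. h \<notin> J \<longrightarrow> colon J g \<subseteq> colon J h \<longrightarrow> colon J h = colon J g)}"

lemma maximal_colonsE:
  assumes "P \<in> maximal_colons J"
  obtains g where "P = colon J g" "g \<notin> J" "\<And>h. h \<notin> J \<Longrightarrow> P \<subseteq> colon J h \<Longrightarrow> colon J h = P"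
  using assms unfolding maximal_colons_def by auto

text \<open>
  If \<open>a \<notin> (J : g)\<close>, then \<open>(J : a g)\<close> is proper and contains \<open>(J : g)\<close>, so that both are equal.
\<close>

lemma maximal_colon_prime:
  assumes J: "ideal.subspace J" and P: "P \<in> maximal_colons J" and ab: "a * b \<in> P"
  shows "a \<in> P \<or> b \<in> P"
proof -
  obtain g where g: "P = colon J g"
    and max: "\<And>h. h \<notin> J \<Longrightarrow> P \<subseteq> colon J h \<Longrightarrow> colon J h = P"
    using P by (rule maximal_colonsE) blast
  show ?thesis
  proof (cases "a \<in> P")
    case False
    have "P \<subseteq> colon J (a * g)"
      unfolding g using ideal_mult(1)[OF J] by (auto simp: mult.left_commute[of _ a])
    then have "colon J (a * g) = P" using max[of "a * g"] False g by simp
    moreover have "b \<in> colon J (a * g)"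
      using ab g by (simp add: mult.assoc mult.left_commute[of b])
    ultimately show ?thesis by simp
  qed simp
qed

lemma one_notin_maximal_colon: "P \<in> maximal_colons J \<Longrightarrow> 1 \<notin> P"
  by (auto simp: maximal_colons_def)

lemma prod_notin_prime:
  assumes "\<And>a b. a * b \<in> P \<Longrightarrow> a \<in> P \<or> b \<in> P" "1 \<notin> P" "finite A" "\<And>i. i \<in> A \<Longrightarrow> p i \<notin> P"
  shows "prod p A \<notin> (P :: 'a::comm_ring_1 set)"
  using assms(3,4) by (induction A) (use assms(1,2) in auto)

text \<open>
  Suppose that \<open>P k = (J : g k)\<close> are infinitely many of them. The ideals generated by \<open>J\<close> and
  \<open>g 0, \<dots>, g (k - 1)\<close> become stationary, so some \<open>g k\<close> lies in the ideal of its predecessors, and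
  \<open>P k\<close> contains the intersection of the earlier \<open>P i\<close>. As \<open>P k\<close> is prime, it contains one of them;
  by maximality it equals this one.
\<close>

lemma finite_maximal_colons:
  fixes J :: "('n::finite, 'k::field) mpoly set"
  assumes J: "ideal.subspace J"
  shows "finite (maximal_colons J)"
proof (rule ccontr)
  assume "infinite (maximal_colons J)"
  then obtain P :: "nat \<Rightarrow> ('n, 'k) mpoly set" where P: "inj P" "range P \<subseteq> maximal_colons J"
    using infinite_countable_subset by blast
  define witness where "witness k g \<longleftrightarrow> P k = colon J g \<and> g \<notin> J \<and>
    (\<forall>h. h \<notin> J \<longrightarrow> P k \<subseteq> colon J h \<longrightarrow> colon J h = P k)" for k g
  have "\<exists>g. witness k g" for k
  proof -
    have "P k \<in> maximal_colons J" using P(2) by blast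
    then show ?thesis unfolding witness_def by (rule maximal_colonsE) blast
  qed
  then obtain g where witness: "\<And>k. witness k (g k)" by metis
  have g: "P k = colon J (g k)" "g k \<notin> J" for k
    using witness[of k] unfolding witness_def by blast+
  have max: "colon J h = P k" if "h \<notin> J" "P k \<subseteq> colon J h" for k h
    using witness[of k] that unfolding witness_def by blast
  define K where "K k = ideal.span (J \<union> g ` {..<k})" for k
  obtain k where "K (Suc k) = K k"
  proof (rule ideal_chain_stabilizes[of K])
    show "ideal.subspace (K k)" for k unfolding K_def by (rule ideal.subspace_span)
    show "K k \<subseteq> K (Suc k)" for k unfolding K_def by (rule ideal.span_mono) auto
  qed
  moreover have "g k \<in> K (Suc k)" unfolding K_def by (intro ideal.span_base) auto
  ultimately have gk: "g k \<in> K k" by simp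
  have "\<exists>p. p \<in> P i \<and> p \<notin> P k" if "i < k" for i
  proof (rule ccontr)
    assume "\<not> ?thesis"
    then have "P i \<subseteq> colon J (g k)" using g(1) by blast
    then have "P k = P i" using max[OF g(2)[of k], of i] g(1) by simp
    with P(1) that show False by (auto dest: injD)
  qed
  then obtain p where p: "\<And>i. i < k \<Longrightarrow> p i \<in> P i" "\<And>i. i < k \<Longrightarrow> p i \<notin> P k" by metis
  \<comment> \<open>\<open>q\<close> lies in every earlier \<open>P i\<close>, hence annihilates \<open>g k\<close> modulo \<open>J\<close>, but it avoids the prime \<open>P k\<close>.\<close>
  define q where "q = prod p {..<k}"
  have "q \<notin> P k" unfolding q_def
    using P(2) maximal_colon_prime[OF J, of "P k"] one_notin_maximal_colon[of "P k" J] p(2)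
    by (intro prod_notin_prime) auto
  moreover have "K k \<subseteq> colon J q" unfolding K_def
  proof (intro ideal.span_minimal ideal_colon[OF J] Un_least image_subsetI subsetI)
    fix x assume "x \<in> J"
    then show "x \<in> colon J q" using ideal_mult(2)[OF J] by simp
  next
    fix i assume "i \<in> {..<k}"
    then have "q = p i * prod p ({..<k} - {i})" unfolding q_def by (intro prod.remove) auto
    moreover have "p i * g i \<in> J" using p(1) g(1) \<open>i \<in> {..<k}\<close> by auto
    ultimately show "g i \<in> colon J q"
      using ideal_mult(2)[OF J, of "p i * g i" "prod p ({..<k} - {i})"]
      by (simp add: mult.assoc mult.left_commute mult.commute)
  qed
  ultimately show False using gk g(1) by (auto simp: mult.commute)
qed

lemma cmult_const: "cmult c p = const c * p"
  by (simp add: cmult_def)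

lemma ideal_lin_subspace: "ideal.subspace J \<Longrightarrow> lin.subspace J"
  by (rule lin.subspaceI)
    (auto simp: cmult_def ideal.subspace_0 ideal.subspace_add intro: ideal_mult(1))

text \<open>
  Linear forms whose coefficient vectors run along a monomial curve. If the exponents are distinct, any
  sufficiently many of them span all linear forms; so over an infinite field a general member of this
  one-parameter family is as good as a general linear form.
\<close>

definition moment_form :: "('n::finite \<Rightarrow> nat) \<Rightarrow> 'k::field \<Rightarrow> ('n, 'k) mpoly" where
  "moment_form e c = (\<Sum>i\<in>UNIV. cmult (c ^ e i) (var i))"

lemma lin_separating_functional:
  fixes W :: "('n, 'k::field) mpoly set"
  assumes W: "lin.subspace W" and x: "x \<notin> W"
  obtains \<phi> :: "('n, 'k) mpoly \<Rightarrow> 'k" where "Vector_Spaces.linear cmult (*) \<phi>"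
    "\<And>w. w \<in> W \<Longrightarrow> \<phi> w = 0" "\<phi> x = 1"
proof -
  interpret pair: vector_space_pair "cmult :: 'k \<Rightarrow> ('n, 'k) mpoly \<Rightarrow> _" "(*) :: 'k \<Rightarrow> 'k \<Rightarrow> 'k"
    by unfold_locales (simp_all add: algebra_simps)
  obtain B where B: "B \<subseteq> W" "lin.independent B" "W \<subseteq> lin.span B"
    using lin.maximal_independent_subset by blast
  then have span: "lin.span B = W" using W by (simp add: lin.span_subspace)
  then have ind: "lin.independent (insert x B)" using x B by (simp add: lin.independent_insertI)
  obtain \<phi> where \<phi>: "Vector_Spaces.linear cmult (*) \<phi>"
    "\<forall>b\<in>insert x B. \<phi> b = (if b = x then 1 else 0)"
    using pair.linear_independent_extend[OF ind, of "\<lambda>b. if b = x then 1 else 0"] by blast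
  have "\<phi> w = 0" if "w \<in> W" for w
  proof (rule pair.linear_eq_0_on_span[OF \<phi>(1)])
    show "w \<in> lin.span B" using that span by simp
    show "\<phi> b = 0" if "b \<in> B" for b using that \<phi>(2) B(1) x by auto
  qed
  with \<phi> that show thesis by auto
qed

text \<open>
  A linear functional that vanishes on \<open>W\<close> but not at \<open>var i\<close> takes at \<open>moment_form e c\<close> the value of
  a nonzero polynomial in \<open>c\<close>, because distinct variables contribute distinct powers of \<open>c\<close>. Such a
  polynomial has finitely many zeros.
\<close>

lemma moment_forms_span:
  fixes W :: "('n::finite, 'k::field) mpoly set"
  assumes W: "lin.subspace W" and e: "inj e" and inf: "infinite {c. moment_form e c \<in> W}"
  shows "var i \<in> W"
proof (rule ccontr)
  assume "var i \<notin> W"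
  then obtain \<phi> :: "('n, 'k) mpoly \<Rightarrow> 'k" where \<phi>: "Vector_Spaces.linear cmult (*) \<phi>"
    "\<And>w. w \<in> W \<Longrightarrow> \<phi> w = 0" "\<phi> (var i) = 1"
    using lin_separating_functional[OF W] by blast
  interpret \<phi>: Vector_Spaces.linear "cmult :: 'k \<Rightarrow> ('n, 'k) mpoly \<Rightarrow> _" "(*) :: 'k \<Rightarrow> 'k \<Rightarrow> 'k" \<phi>
    by (rule \<phi>(1))
  define p where "p = (\<Sum>j\<in>UNIV. monom (\<phi> (var j)) (e j))"
  have "poly p c = \<phi> (moment_form e c)" for c
    by (simp add: p_def moment_form_def poly_sum poly_monom \<phi>.sum \<phi>.scale mult.commute)
  then have "{c. moment_form e c \<in> W} \<subseteq> {c. poly p c = 0}" using \<phi>(2) by auto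
  moreover have "coeff p (e i) = 1"
    using e \<phi>(3) by (simp add: p_def coeff_sum inj_eq)
  then have "finite {c. poly p c = 0}" by (intro poly_roots_finite) auto
  ultimately show False using inf finite_subset by blast
qed

text \<open>
  A zero divisor modulo \<open>J\<close> lies in one of the finitely many maximal quotients \<open>(J : g)\<close>. None of them
  contains all variables, since \<open>J\<close> is saturated; hence each contains only finitely many members of
  the family.
\<close>

lemma finite_moment_form_zero_divisors:
  fixes J :: "('n::finite, 'k::field) mpoly set"
  assumes J: "ideal.subspace J" and e: "inj e"
    and sat: "\<And>g. (\<And>i. var i * g \<in> J) \<Longrightarrow> g \<in> J"
  shows "finite {c. \<not> regular_for_quotient (moment_form e c) J}"
proof (rule finite_subset)
  show "{c. \<not> regular_for_quotient (moment_form e c) J} \<subseteq>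
    (\<Union>P\<in>maximal_colons J. {c. moment_form e c \<in> P})"
  proof clarify
    fix c assume "\<not> regular_for_quotient (moment_form e c) J"
    then obtain h where h: "moment_form e c \<in> colon J h" "h \<notin> J"
      by (auto simp: regular_for_quotient_iff[OF J])
    let ?F = "{colon J g | g. g \<notin> J \<and> moment_form e c \<in> colon J g}"
    obtain M where M: "M \<in> ?F" "\<And>K. K \<in> ?F \<Longrightarrow> M \<subseteq> K \<Longrightarrow> K = M"
      by (rule ideal_family_maximal[of ?F "colon J h"]) (use h in \<open>auto intro: ideal_colon[OF J]\<close>)
    then have "M \<in> maximal_colons J" unfolding maximal_colons_def by blast
    with M(1) show "c \<in> (\<Union>P\<in>maximal_colons J. {c. moment_form e c \<in> P})" by blast
  qed
  have "finite {c. moment_form e c \<in> P}" if P: "P \<in> maximal_colons J" for P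
  proof (rule ccontr)
    obtain g where g: "P = colon J g" "g \<notin> J" using P by (rule maximal_colonsE) blast
    assume "infinite {c. moment_form e c \<in> P}"
    then have "var i \<in> colon J g" for i
      unfolding g(1) by (rule moment_forms_span[OF ideal_lin_subspace[OF ideal_colon[OF J]] e])
    with sat[of g] g(2) show False by simp
  qed
  then show "finite (\<Union>P\<in>maximal_colons J. {c. moment_form e c \<in> P})"
    using finite_maximal_colons[OF J] by blast
qed

text \<open>
  Over a finite field, the product of all \<open>x - a\<close> plus one has no root.
\<close>

lemma infinite_alg_closed_field: "infinite (UNIV :: 'k::alg_closed_field set)"
proof
  assume fin: "finite (UNIV :: 'k set)"
  define p :: "'k poly" where "p = (\<Prod>a\<in>UNIV. [:-a, 1:])"
  have "degree p = card (UNIV :: 'k set)"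
    unfolding p_def by (subst degree_prod_eq_sum_degree) auto
  then have "degree p > 0" using fin by (simp add: card_gt_0_iff)
  then have "degree (p + 1) > 0" by (simp add: degree_add_eq_left)
  then obtain x where "poly (p + 1) x = 0" using alg_closed_imp_poly_has_root by blast
  moreover have "poly p x = 0"
    unfolding p_def poly_prod using fin by (intro prod_zero) auto
  ultimately show False by simp
qed

section \<open>Maximal homogeneous ideals without a power of the irrelevant ideal\<close>

definition prime_on_forms :: "('n::finite, 'k::comm_ring_1) mpoly set \<Rightarrow> bool" where
  "prime_on_forms Q \<longleftrightarrow>
    (\<forall>a b d e. form d a \<longrightarrow> form e b \<longrightarrow> a * b \<in> Q \<longrightarrow> a \<in> Q \<or> b \<in> Q)"

text \<open>
  Any \<open>Q\<close> that is maximal among the homogeneous ideals above \<open>J\<close> without a power of the irrelevant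
  ideal has the required properties. Over an algebraically closed field it is the ideal of a projective
  zero of \<open>J\<close>, and it stands for this zero in what follows. If \<open>a\<close> and \<open>b\<close> are forms outside \<open>Q\<close>,
  then \<open>(Q, a)\<close> and \<open>(Q, b)\<close> contain powers of the irrelevant ideal, and \<open>(Q, a b)\<close> contains their
  product.
\<close>

lemma graded_maximal_prime:
  fixes J :: "('n::finite, 'k::field) mpoly set"
  assumes J: "ideal.subspace J" "graded J" "\<not> contains_power J"
  obtains Q where "ideal.subspace Q" "graded Q" "\<not> contains_power Q" "J \<subseteq> Q"
    "\<And>a d. form d a \<Longrightarrow> a \<notin> Q \<Longrightarrow> contains_power (ideal.span (insert a Q))"
    "prime_on_forms Q"
proof -
  let ?F = "{Q. ideal.subspace Q \<and> graded Q \<and> \<not> contains_power Q \<and> J \<subseteq> Q}"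
  obtain Q where Q: "Q \<in> ?F" and max: "\<And>K. K \<in> ?F \<Longrightarrow> Q \<subseteq> K \<Longrightarrow> K = Q"
    by (rule ideal_family_maximal[of ?F J]) (use J in auto)
  have big: "contains_power (ideal.span (insert a Q))" if "form d a" "a \<notin> Q" for a d
  proof (rule ccontr)
    let ?K = "ideal.span (insert a Q)"
    have sub: "insert a Q \<subseteq> ?K" by (rule ideal.span_superset)
    assume "\<not> contains_power ?K"
    with Q sub graded_span_insert[of Q d a] that have "?K \<in> ?F" by auto
    with max sub have "?K = Q" by blast
    with sub that show False by blast
  qed
  have "a \<in> Q \<or> b \<in> Q" if ab: "form d a" "form e b" "a * b \<in> Q" for a b d e
  proof (rule ccontr)
    assume "\<not> ?thesis"
    then obtain s t where s: "\<And>m. mdeg m = s \<Longrightarrow> mon m \<in> ideal.span (insert a Q)"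
      and t: "\<And>m. mdeg m = t \<Longrightarrow> mon m \<in> ideal.span (insert b Q)"
      using big[OF ab(1)] big[OF ab(2)] unfolding contains_power_def by blast
    have idQ: "ideal.subspace Q" using Q by simp
    have "(mon m :: ('n, 'k) mpoly) \<in> Q" if m: "mdeg m = s + t" for m
    proof -
      obtain m1 m2 where m12: "m = m1 + m2" "mdeg m1 = s" using exponent_split[of s m] m by auto
      then have "mdeg m2 = t" using m unfolding m12(1) mdeg_add by linarith
      with s t m12 have "mon m1 \<in> ideal.span (insert a Q)" "mon m2 \<in> ideal.span (insert b Q)" by auto
      then obtain x y where x: "mon m1 - x * a \<in> Q" and y: "mon m2 - y * b \<in> Q"
        using idQ by (auto simp: ideal.span_breakdown_eq ideal.span_eq_iff[THEN iffD2])
      have "mon m = mon m1 * (mon m2 - y * b) + (y * b) * (mon m1 - x * a) + (x * y) * (a * b)"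
        unfolding m12(1) mon_add by (simp add: algebra_simps)
      also have "\<dots> \<in> Q"
        by (intro ideal.subspace_add[OF idQ] ideal_mult(1)[OF idQ] x y ab(3))
      finally show ?thesis .
    qed
    then have "contains_power Q" by (rule contains_powerI)
    with Q show False by simp
  qed
  then have "prime_on_forms Q" unfolding prime_on_forms_def by blast
  with Q big that show thesis by blast
qed

section \<open>Linear forms modulo a maximal homogeneous ideal\<close>

lemma finite_exponents: "finite {m :: 'n::finite \<Rightarrow>\<^sub>0 nat. mdeg m = t}"
proof -
  have "Poly_Mapping.lookup m i \<le> mdeg m" for m :: "'n \<Rightarrow>\<^sub>0 nat" and i
    by (rule member_le_sum) auto
  then have "Poly_Mapping.lookup ` {m :: 'n \<Rightarrow>\<^sub>0 nat. mdeg m = t} \<subseteq>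
      {f. \<forall>x. (x \<in> UNIV \<longrightarrow> f x \<in> {..t}) \<and> (x \<notin> UNIV \<longrightarrow> f x = 0)}" by auto
  moreover have "finite {f :: 'n \<Rightarrow> nat. \<forall>x. (x \<in> UNIV \<longrightarrow> f x \<in> {..t}) \<and> (x \<notin> UNIV \<longrightarrow> f x = 0)}"
    by (intro finite_set_of_finite_funs) auto
  ultimately have "finite (Poly_Mapping.lookup ` {m :: 'n \<Rightarrow>\<^sub>0 nat. mdeg m = t})"
    by (rule finite_subset)
  then show ?thesis
  proof (rule finite_imageD)
    show "inj_on Poly_Mapping.lookup {m :: 'n \<Rightarrow>\<^sub>0 nat. mdeg m = t}"
      by (rule inj_onI) (simp only: poly_mapping.lookup_inject)
  qed
qed

text \<open>
  More vectors than the size of a spanning set are dependent as a family. Repetitions in the family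
  give a relation directly; the notion of dependence for sets does not see them.
\<close>

lemma lin_relation:
  fixes a :: "nat \<Rightarrow> ('n, 'k::field) mpoly"
  assumes T: "finite T" "card T \<le> r" and a: "\<And>j. j \<le> r \<Longrightarrow> a j \<in> lin.span T"
  obtains c where "(\<Sum>j\<le>r. cmult (c j) (a j)) = 0" "\<exists>j\<le>r. c j \<noteq> 0"
proof (cases "inj_on a {..r}")
  case True
  have "lin.dependent (a ` {..r})"
  proof (rule ccontr)
    assume "lin.independent (a ` {..r})"
    then have "card (a ` {..r}) \<le> card T"
      using lin.independent_span_bound[OF T(1)] a by blast
    with T(2) card_image[OF True] show False by simp
  qed
  then obtain u where u: "(\<Sum>v\<in>a ` {..r}. cmult (u v) v) = 0" "\<exists>v\<in>a ` {..r}. u v \<noteq> 0"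
    by (auto simp: lin.dependent_finite)
  show thesis
    by (rule that[of "u \<circ> a"]) (use u True in \<open>auto simp: sum.reindex\<close>)
next
  case False
  then obtain i j where ij: "i \<le> r" "j \<le> r" "i \<noteq> j" "a i = a j" by (auto simp: inj_on_def)
  let ?c = "\<lambda>x. (if x = i then 1 else 0) - (if x = j then 1 else 0) :: 'k"
  have "cmult (?c x) (a x) = (if x = i then a i else 0) - (if x = j then a j else 0)" for x
    using ij by (auto simp: lin.scale_left_diff_distrib)
  then have "(\<Sum>x\<le>r. cmult (?c x) (a x)) = 0"
    using ij by (simp add: sum_subtractf)
  then show thesis using ij by (intro that[of ?c]) auto
qed

lemma form_power_linear: "form 1 N \<Longrightarrow> form t (N ^ t)"
  using form_power[of 1 N t] by simp

lemma prime_power: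
  assumes "ideal.subspace Q" "prime_on_forms Q"
    and N: "form 1 N" "N ^ t \<in> Q"
  shows "N \<in> Q"
  using N(2)
proof (induction t)
  case 0
  then show ?case using ideal_mult(1)[OF assms(1), of 1 N] by simp
next
  case (Suc t)
  then show ?case using assms(2) N(1) form_power_linear[OF N(1), of t] by (auto simp: prime_on_forms_def)
qed

text \<open>
  The homogenization of \<open>p\<close> to degree \<open>D\<close>, with \<open>y / N\<close> in place of the variable.
\<close>

definition homogenize :: "nat \<Rightarrow> 'k::field poly \<Rightarrow> ('n, 'k) mpoly \<Rightarrow> ('n, 'k) mpoly \<Rightarrow> ('n, 'k) mpoly" where
  "homogenize D p N y = (\<Sum>j\<le>D. cmult (coeff p j) (N ^ (D - j) * y ^ j))"

lemma form_cmult: "form d p \<Longrightarrow> form d (cmult c p)"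
  by (simp add: cmult_const form_const_mult)

lemma form_homogenize:
  assumes "form 1 N" "form 1 y"
  shows "form D (homogenize D p N y)"
  unfolding homogenize_def
proof (intro form_sum form_cmult)
  fix j assume "j \<in> {..D}"
  then show "form D (N ^ (D - j) * y ^ j)"
    using form_mult[OF form_power_linear[OF assms(1), of "D - j"] form_power_linear[OF assms(2), of j]] by simp
qed

lemma cmult_mult_right: "x * cmult c y = cmult c (x * y)"
  by (simp add: cmult_def mult.left_commute)

lemma homogenize_mult_root:
  assumes "degree q \<le> D"
  shows "homogenize (Suc D) ([:-a, 1:] * q) N y = (y - cmult a N) * homogenize D q N y"
proof -
  have 1: "(\<Sum>j\<le>Suc D. cmult (coeff (pCons 0 q) j) (N ^ (Suc D - j) * y ^ j)) = y * homogenize D q N y"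
    unfolding homogenize_def sum.atMost_Suc_shift sum_distrib_left
    by (simp add: cmult_mult_right mult.left_commute)
  have "(\<Sum>j\<le>Suc D. cmult (coeff q j) (N ^ (Suc D - j) * y ^ j)) =
      (\<Sum>j\<le>D. cmult (coeff q j) (N ^ (Suc D - j) * y ^ j))"
    using assms by (simp add: coeff_eq_0)
  also have "\<dots> = N * homogenize D q N y"
    unfolding homogenize_def sum_distrib_left
    by (intro sum.cong refl) (simp add: cmult_mult_right Suc_diff_le mult.assoc)
  finally have 2: "(\<Sum>j\<le>Suc D. cmult (coeff q j) (N ^ (Suc D - j) * y ^ j)) = N * homogenize D q N y" .
  have "[:-a, 1:] * q = pCons 0 q - smult a q" by simp
  then have "homogenize (Suc D) ([:-a, 1:] * q) N y =
      (\<Sum>j\<le>Suc D. cmult (coeff (pCons 0 q) j) (N ^ (Suc D - j) * y ^ j)) -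
      cmult a (\<Sum>j\<le>Suc D. cmult (coeff q j) (N ^ (Suc D - j) * y ^ j))"
    unfolding homogenize_def lin.scale_sum_right
    by (simp only: coeff_diff coeff_smult lin.scale_left_diff_distrib sum_subtractf lin.scale_scale)
  also have "\<dots> = (y - cmult a N) * homogenize D q N y"
    unfolding 1 2 by (simp add: left_diff_distrib cmult_def mult.assoc)
  finally show ?thesis .
qed

text \<open>
  Over an algebraically closed field the homogenization splits into factors \<open>N\<close> and \<open>y - a N\<close>, one of
  which lies in the prime \<open>Q\<close>; it is not \<open>N\<close>.
\<close>

lemma linear_factor_in_prime:
  fixes Q :: "('n::finite, 'k::alg_closed_field) mpoly set"
  assumes Q: "ideal.subspace Q"
    and prime: "prime_on_forms Q"
    and N: "form 1 N" "N \<notin> Q" and y: "form 1 y"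
    and p: "p \<noteq> 0" "degree p \<le> D" "homogenize D p N y \<in> Q"
  shows "\<exists>a. y - cmult a N \<in> Q"
  using p
proof (induction "degree p" arbitrary: p D)
  case 0
  then obtain c where c: "p = [:c:]" "c \<noteq> 0" by (metis degree_eq_zeroE pCons_0_0)
  have "homogenize D p N y = (\<Sum>j\<le>D. if j = 0 then cmult c (N ^ D) else 0)"
    unfolding homogenize_def c by (intro sum.cong) (auto simp: coeff_pCons split: nat.split)
  then have "cmult c (N ^ D) \<in> Q" using 0 by simp
  then have "cmult (inverse c) (cmult c (N ^ D)) \<in> Q"
    using ideal_lin_subspace[OF Q] lin.subspace_scale by blast
  then have "N ^ D \<in> Q" using c(2) by simp
  with prime_power[OF Q prime N(1)] N(2) show ?case by blast
next
  case (Suc k)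
  then obtain a where "poly p a = 0" using alg_closed_imp_poly_has_root[of p] by auto
  then obtain q where q: "p = [:-a, 1:] * q" by (auto simp: poly_eq_0_iff_dvd)
  with Suc.prems have "q \<noteq> 0" by auto
  have "degree p = Suc (degree q)" unfolding q using \<open>q \<noteq> 0\<close> by (subst degree_mult_eq) auto
  moreover from this obtain D' where D: "D = Suc D'" using Suc.prems by (cases D) auto
  ultimately have deg: "k = degree q" "degree q \<le> D'" using Suc by auto
  have "(y - cmult a N) * homogenize D' q N y \<in> Q"
    using Suc.prems(3) unfolding D q homogenize_mult_root[OF deg(2)] .
  moreover have "form 1 (y - cmult a N)" using y N(1) by (intro form_diff form_cmult)
  ultimately have "y - cmult a N \<in> Q \<or> homogenize D' q N y \<in> Q"
    using prime form_homogenize[OF N(1) y] unfolding prime_on_forms_def by blast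
  with Suc.hyps(1)[OF deg(1) \<open>q \<noteq> 0\<close> deg(2)] show ?case by blast
qed

text \<open>
  The Nullstellensatz for the point that \<open>Q\<close> stands for; the value of \<open>y / N\<close> at this point is \<open>a\<close>.
  Since \<open>(N, Q)\<close> contains all forms of degree at least \<open>t\<close>, multiplication by \<open>N\<close> is onto from each
  such degree of \<open>S / Q\<close> to the next. So the dimension of \<open>S / Q\<close> in large degrees is bounded by the
  number \<open>r\<close> of monomials of degree \<open>t\<close>. In degree \<open>t + r\<close> there are at least \<open>r + 1\<close> products of
  powers of \<open>N\<close> and \<open>y\<close>; a linear relation between them modulo \<open>Q\<close> is a binary form in \<open>N\<close> and \<open>y\<close>
  that lies in \<open>Q\<close>.
\<close>

lemma linear_form_multiple_mod_maximal:
  fixes Q :: "('n::finite, 'k::alg_closed_field) mpoly set"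
  assumes Q: "ideal.subspace Q" "graded Q"
    and big: "contains_power (ideal.span (insert N Q))"
    and prime: "prime_on_forms Q"
    and N: "form 1 N" "N \<notin> Q" and y: "form 1 y"
  shows "\<exists>a. y - cmult a N \<in> Q"
proof -
  obtain t where t: "\<And>e u. t \<le> e \<Longrightarrow> form e u \<Longrightarrow> u \<in> ideal.span (insert N Q)"
    using contains_power_eventually[OF ideal.subspace_span big] by metis
  have reduce: "\<exists>v. form t v \<and> u - N ^ k * v \<in> Q" if "form (t + k) u" for k u
    using that
  proof (induction k arbitrary: u)
    case 0
    then show ?case using ideal.subspace_0[OF Q(1)] by (intro exI[of _ u]) simp
  next
    case (Suc k)
    then have "u \<in> ideal.span (insert N Q)" by (intro t) auto
    then obtain b where b: "u - b * N \<in> Q"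
      using Q(1) by (auto simp: ideal.span_breakdown_eq ideal.span_eq_iff[THEN iffD2])
    define h where "h = hcomp (t + k) b"
    have "hcomp (t + Suc k) (u - b * N) \<in> Q" using Q(2) b by (simp add: graded_def)
    moreover have "hcomp (t + Suc k) u = hcomp (t + Suc k) (u - b * N) + hcomp (t + Suc k) (b * N)"
      by (subst hcomp_add[symmetric]) simp
    then have "hcomp (t + Suc k) (u - b * N) = u - h * N"
      using hcomp_form[OF Suc.prems, of "t + Suc k"] hcomp_mult_form[OF N(1), of "t + Suc k" b]
      by (simp add: h_def eq_diff_eq)
    ultimately have 1: "u - h * N \<in> Q" by simp
    obtain v where v: "form t v" "h - N ^ k * v \<in> Q"
      using Suc.IH[of h] form_hcomp unfolding h_def by blast
    have "u - N ^ Suc k * v = (u - h * N) + N * (h - N ^ k * v)"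
      by (simp add: algebra_simps)
    also have "\<dots> \<in> Q"
      by (intro ideal.subspace_add[OF Q(1)] ideal_mult(1)[OF Q(1)] 1 v(2))
    finally show ?case using v(1) by blast
  qed
  define r where "r = card {m :: 'n \<Rightarrow>\<^sub>0 nat. mdeg m = t}"
  define T where "T = (\<lambda>m. N ^ r * mon m) ` {m :: 'n \<Rightarrow>\<^sub>0 nat. mdeg m = t}"
  have T: "finite T" "card T \<le> r"
    unfolding T_def r_def using finite_exponents by (auto intro: card_image_le)
  have in_span: "N ^ r * v \<in> lin.span T" if "form t v" for v
  proof -
    have "N ^ r * v = (\<Sum>m\<in>Poly_Mapping.keys v. cmult (Poly_Mapping.lookup v m) (N ^ r * mon m))"
      by (subst mpoly_as_sum[of v])
        (simp add: sum_distrib_left cmult_mult_right[symmetric], simp add: cmult_def mult_single)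
    also have "\<dots> \<in> lin.span T"
      using that by (intro lin.span_sum lin.span_scale lin.span_base) (auto simp: T_def form_def)
    finally show ?thesis .
  qed
  define u where "u j = N ^ (t + r - j) * y ^ j" for j
  have "\<exists>v. form t v \<and> u j - N ^ r * v \<in> Q" if "j \<le> r" for j
    using form_mult[OF form_power_linear[OF N(1), of "t + r - j"] form_power_linear[OF y, of j]] that
    by (intro reduce) (simp add: u_def)
  then obtain v where v: "\<And>j. j \<le> r \<Longrightarrow> form t (v j)" "\<And>j. j \<le> r \<Longrightarrow> u j - N ^ r * v j \<in> Q"
    by metis
  obtain c where c: "(\<Sum>j\<le>r. cmult (c j) (N ^ r * v j)) = 0" "\<exists>j\<le>r. c j \<noteq> 0"
    using lin_relation[OF T, of "\<lambda>j. N ^ r * v j"] in_span v(1) by blast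
  define p where "p = (\<Sum>j\<le>r. monom (c j) j)"
  have coeff_p: "coeff p j = (if j \<le> r then c j else 0)" for j
    by (simp add: p_def coeff_sum)
  have "homogenize (t + r) p N y = (\<Sum>j\<le>r. cmult (c j) (u j))"
    unfolding homogenize_def by (rule sum.mono_neutral_cong_right) (auto simp: coeff_p u_def)
  also have "\<dots> = (\<Sum>j\<le>r. cmult (c j) (u j - N ^ r * v j))"
    using c(1) by (simp add: lin.scale_right_diff_distrib sum_subtractf)
  also have "\<dots> \<in> Q"
    using ideal_lin_subspace[OF Q(1)] v(2) by (auto intro!: lin.subspace_sum lin.subspace_scale)
  finally have "homogenize (t + r) p N y \<in> Q" .
  moreover have "p \<noteq> 0" using c(2) coeff_p by (metis coeff_0)
  moreover have "degree p \<le> r" by (rule degree_le) (simp add: coeff_p)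
  then have "degree p \<le> t + r" by simp
  ultimately show ?thesis
    using linear_factor_in_prime[OF Q(1) prime N y] by blast
qed

lemma form_moment_form: "form 1 (moment_form e c)"
  unfolding moment_form_def by (intro form_sum form_cmult form_var)

lemma linear_form_in_ideal:
  assumes J: "ideal.subspace J" "\<And>i. var i \<in> J" and p: "form 1 p"
  shows "p \<in> J"
proof (rule form_in_ideal[OF J(1) _ p order_refl])
  fix m :: "'a \<Rightarrow>\<^sub>0 nat" assume "mdeg m = 1"
  then obtain a i where "(mon m :: ('a, 'b) mpoly) = mon a * var i" using mon_SucE[of m 0]
    by (metis One_nat_def)
  then show "mon m \<in> J" using J(2) ideal_mult(1)[OF J(1)] by simp
qed

section \<open>Essential elements\<close>

text \<open>
  The linear forms \<open>M i = var i - a i N\<close> vanish at the point that \<open>Q\<close> stands for, and together with \<open>N\<close>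
  they generate all variables. They are one too many: combining them with the coefficients of \<open>N\<close> gives
  a multiple of \<open>N\<close> in \<open>Q\<close>, which must be zero, and this relation makes one of them redundant.
\<close>

lemma linear_generators_through_point:
  fixes Q :: "('n::finite, 'k::alg_closed_field) mpoly set" and c :: "'n \<Rightarrow> 'k"
  assumes Q: "ideal.subspace Q" "graded Q" "prime_on_forms Q"
    and big: "contains_power (ideal.span (insert N Q))"
    and N_def: "N = (\<Sum>i\<in>UNIV. cmult (c i) (var i))" and NQ: "N \<notin> Q"
  obtains M :: "'n \<Rightarrow> ('n, 'k) mpoly" and j where "\<And>i. form 1 (M i)" "\<And>i. M i \<in> Q"
    "ideal.span (M ` (UNIV - {j}) \<union> {N}) = irrelevant_ideal"
proof -
  have linQ: "lin.subspace Q" by (rule ideal_lin_subspace[OF Q(1)])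
  have N: "form 1 N" unfolding N_def by (intro form_sum form_cmult form_var)
  have "\<exists>a. var i - cmult a N \<in> Q" for i
    using linear_form_multiple_mod_maximal[OF Q(1,2) big Q(3) N NQ form_var] .
  then obtain a where a: "\<And>i. var i - cmult (a i) N \<in> Q" by metis
  define M where "M i = var i - cmult (a i) N" for i
  have M: "form 1 (M i)" "M i \<in> Q" for i
    unfolding M_def by (intro form_diff form_var form_cmult N) (rule a)
  define s where "s = (\<Sum>i\<in>UNIV. c i * a i)"
  have sum_M: "(\<Sum>i\<in>UNIV. cmult (c i) (M i)) = cmult (1 - s) N"
    by (simp add: M_def s_def lin.scale_right_diff_distrib sum_subtractf lin.scale_left_diff_distrib
        lin.scale_sum_left N_def)
  have "s = 1"
  proof (rule ccontr)
    assume "s \<noteq> 1"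
    have "cmult (1 - s) N \<in> Q"
      unfolding sum_M[symmetric] using M(2) by (intro lin.subspace_sum[OF linQ] lin.subspace_scale[OF linQ])
    then have "cmult (inverse (1 - s)) (cmult (1 - s) N) \<in> Q"
      by (rule lin.subspace_scale[OF linQ])
    with NQ \<open>s \<noteq> 1\<close> show False by simp
  qed
  have "\<exists>j. c j \<noteq> 0"
  proof (rule ccontr)
    assume "\<not> ?thesis"
    then have "s = 0" unfolding s_def by simp
    with \<open>s = 1\<close> show False by simp
  qed
  then obtain j where j: "c j \<noteq> 0" by blast
  let ?S = "ideal.span (M ` (UNIV - {j}) \<union> {N})"
  have "?S = irrelevant_ideal"
  proof
    show "?S \<subseteq> irrelevant_ideal"
    proof (rule ideal.span_minimal)
      have "p \<in> irrelevant_ideal" if "form 1 p" for p :: "('n, 'k) mpoly"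
        unfolding irrelevant_ideal_def
        by (rule linear_form_in_ideal[OF ideal.subspace_span ideal.span_base that]) simp
      then show "M ` (UNIV - {j}) \<union> {N} \<subseteq> irrelevant_ideal" using M N by auto
    qed (simp add: irrelevant_ideal_def)
    have linS: "lin.subspace ?S" by (rule ideal_lin_subspace[OF ideal.subspace_span])
    have MS: "M i \<in> ?S" if "i \<noteq> j" for i
      using that by (intro ideal.span_base) auto
    have "cmult (c j) (M j) = - (\<Sum>i\<in>UNIV - {j}. cmult (c i) (M i))"
      using sum_M \<open>s = 1\<close> by (simp add: sum.remove[of UNIV j] eq_neg_iff_add_eq_0)
    also have "\<dots> \<in> ?S"
      using MS by (intro lin.subspace_neg[OF linS] lin.subspace_sum[OF linS] lin.subspace_scale[OF linS]) auto
    finally have "cmult (inverse (c j)) (cmult (c j) (M j)) \<in> ?S"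
      by (rule lin.subspace_scale[OF linS])
    then have "M j \<in> ?S" using j by simp
    with MS have MS: "M i \<in> ?S" for i by (cases "i = j") auto
    have "N \<in> ?S" by (rule ideal.span_base) simp
    then have "M i + cmult (a i) N \<in> ?S" for i
      by (intro lin.subspace_add[OF linS] lin.subspace_scale[OF linS] MS)
    then show "irrelevant_ideal \<subseteq> ?S"
      unfolding irrelevant_ideal_def by (intro ideal.span_minimal) (auto simp: M_def)
  qed
  then show thesis by (rule that[of M j, OF M])
qed

text \<open>
  Membership of \<open>f g\<close> in \<open>(B, A f)\<close> puts \<open>g\<close> into \<open>((B) : f) + (A)\<close>, hence into \<open>Q\<close>.
\<close>

lemma cofactor_in_ideal:
  fixes Q :: "'a::comm_ring_1 set"
  assumes Q: "ideal.subspace Q" "colon (ideal.span B) f \<subseteq> Q" "A \<subseteq> Q"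
    and fg: "f * g \<in> ideal.span (B \<union> (\<lambda>q. q * f) ` A)"
  shows "g \<in> Q"
proof -
  have "ideal.span ((\<lambda>q. q * f) ` A) \<subseteq> (\<lambda>q. q * f) ` Q"
  proof (rule ideal.span_minimal)
    show "(\<lambda>q. q * f) ` A \<subseteq> (\<lambda>q. q * f) ` Q" using Q(3) by (rule image_mono)
    show "ideal.subspace ((\<lambda>q. q * f) ` Q)"
    proof (rule ideal.subspaceI)
      show "0 \<in> (\<lambda>q. q * f) ` Q"
        using ideal.subspace_0[OF Q(1)] by (intro image_eqI[of _ _ 0]) simp_all
    next
      fix x y assume "x \<in> (\<lambda>q. q * f) ` Q" "y \<in> (\<lambda>q. q * f) ` Q"
      then obtain p q where "x + y = (p + q) * f" "p \<in> Q" "q \<in> Q" by (auto simp: distrib_right)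
      then show "x + y \<in> (\<lambda>q. q * f) ` Q" using ideal.subspace_add[OF Q(1)] by blast
    next
      fix r x assume "x \<in> (\<lambda>q. q * f) ` Q"
      then obtain q where "r * x = (r * q) * f" "q \<in> Q" by (auto simp: mult.assoc)
      then show "r * x \<in> (\<lambda>q. q * f) ` Q" using ideal_mult(1)[OF Q(1)] by blast
    qed
  qed
  with fg obtain h q where hq: "f * g = h + q * f" "h \<in> ideal.span B" "q \<in> Q"
    unfolding ideal.span_Un by blast
  then have "(g - q) * f = h" by (simp add: algebra_simps)
  with hq(2) have "g - q \<in> Q" using Q(2) by auto
  then have "(g - q) + q \<in> Q" using hq(3) by (rule ideal.subspace_add[OF Q(1)])
  then show ?thesis by simp
qed

theorem proposition3p2:
  fixes I B1 H :: "('n::finite, 'k::alg_closed_field) mpoly set"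
    and f :: "('n, 'k) mpoly"
    and n d :: nat
  assumes "CARD('n) = n + 1"
    and "homogeneous_ideal I"
    and "saturation I \<subset> irrelevant_ideal"
    and "standard_basis I (insert f B1)"
    and "f \<notin> B1"
    and "f \<in> degree_part I d"
    and "H = ideal.span B1"
  shows "essential (insert f B1) f \<longleftrightarrow>
    (\<exists>(L :: nat \<Rightarrow> ('n, 'k) mpoly) N.
       (\<forall>i\<in>{1..n}. form 1 (L i)) \<and> form 1 N \<and>
       ideal.span (L ` {1..n} \<union> {N}) = irrelevant_ideal \<and>
       (regular_for_quotient N (saturation H) \<and> regular_for_quotient N (saturation I)) \<and>
       (\<forall>t. f * N ^ t \<notin> ideal.span (B1 \<union> {L i * f | i. i \<in> {1..n}})))"
    (is "_ \<longleftrightarrow> (\<exists>L N. ?P L N)")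
proof -
  have idH: "ideal.subspace H" unfolding assms(7) by (rule ideal.subspace_span)
  have idI: "ideal.subspace I" using assms(2) unfolding homogeneous_ideal_def by auto
  have f: "form d f" using assms(6) by (simp add: degree_part_def)
  have grH: "graded H"
    unfolding assms(7) using assms(4) by (intro graded_span_forms) (auto simp: standard_basis_def)
  have inessential: "inessential (insert f B1) f \<longleftrightarrow> contains_power (colon H f)"
    unfolding inessential_def using assms(5,7) saturation_iff[OF idH, of f] by simp
  have "\<not> contains_power (colon H f)" if P: "?P L N" for L N
  proof
    assume "contains_power (colon H f)"
    then obtain t where t: "\<And>e p. t \<le> e \<Longrightarrow> form e p \<Longrightarrow> p \<in> colon H f"
      using contains_power_eventually[OF ideal_colon[OF idH]] by metis
    have "N ^ t \<in> colon H f" using P by (intro t[OF order_refl] form_power_linear) blast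
    then have "f * N ^ t \<in> H" by (simp add: mult.commute)
    then have "f * N ^ t \<in> ideal.span (B1 \<union> {L i * f | i. i \<in> {1..n}})"
      unfolding assms(7) using ideal.span_mono[of B1 "B1 \<union> {L i * f | i. i \<in> {1..n}}"] by blast
    with P show False by blast
  qed
  moreover have "\<exists>L N. ?P L N" if small: "\<not> contains_power (colon H f)"
  proof -
    obtain Q where Q: "ideal.subspace Q" "graded Q" "\<not> contains_power Q" "colon H f \<subseteq> Q"
      and big: "\<And>a d. form d a \<Longrightarrow> a \<notin> Q \<Longrightarrow> contains_power (ideal.span (insert a Q))"
      and prime: "prime_on_forms Q"
      using graded_maximal_prime[OF ideal_colon[OF idH] graded_colon[OF grH f] small] by metis
    obtain e :: "'n \<Rightarrow> nat" where e: "inj e"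
      using finite_imp_inj_to_nat_seg[of "UNIV :: 'n set"] by auto
    \<comment> \<open>All but finitely many members of the one-parameter family are admissible as \<open>N\<close>.\<close>
    have "finite {c. moment_form e c \<in> Q}"
    proof (rule ccontr)
      assume "infinite {c. moment_form e c \<in> Q}"
      then have "var i \<in> Q" for i by (rule moment_forms_span[OF ideal_lin_subspace[OF Q(1)] e])
      then have "contains_power Q"
        using linear_form_in_ideal[OF Q(1)] form_mon by (intro contains_powerI[of 1]) blast
      with Q(3) show False by simp
    qed
    moreover have "finite {c. \<not> regular_for_quotient (moment_form e c) (saturation J)}"
      if "ideal.subspace J" for J :: "('n, 'k) mpoly set"
      using finite_moment_form_zero_divisors[OF ideal_saturation[OF that] e]
        saturation_saturated[OF that] by blast
    ultimately have "finite ({c. moment_form e c \<in> Q}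
        \<union> {c. \<not> regular_for_quotient (moment_form e c) (saturation H)}
        \<union> {c. \<not> regular_for_quotient (moment_form e c) (saturation I)})" (is "finite ?bad")
      using idH idI by simp
    from ex_new_if_finite[OF infinite_alg_closed_field this] obtain c where "c \<notin> ?bad" ..
    define N where "N = moment_form e c"
    from \<open>c \<notin> ?bad\<close> have NQ: "N \<notin> Q"
      and reg: "regular_for_quotient N (saturation H)" "regular_for_quotient N (saturation I)"
      unfolding N_def by blast+
    have N: "form 1 N" unfolding N_def by (rule form_moment_form)
    obtain M :: "'n \<Rightarrow> ('n, 'k) mpoly" and j where M: "\<And>i. form 1 (M i)" "\<And>i. M i \<in> Q"
      and gen: "ideal.span (M ` (UNIV - {j}) \<union> {N}) = irrelevant_ideal"
      by (rule linear_generators_through_point[OF Q(1,2) prime big[OF N NQ]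
            N_def[unfolded moment_form_def] NQ]) blast
    have "card (UNIV - {j}) = n" using assms(1) by simp
    then obtain b where b: "bij_betw b {1..n} (UNIV - {j})"
      using ex_bij_betw_nat_finite_1[of "UNIV - {j}"] by auto
    define L where "L k = M (b k)" for k
    have imL: "L ` {1..n} = M ` (UNIV - {j})"
      unfolding L_def using bij_betw_imp_surj_on[OF b] by (metis image_image)
    have "f * N ^ t \<notin> ideal.span (B1 \<union> {L i * f | i. i \<in> {1..n}})" for t
    proof
      have set_eq: "{L i * f | i. i \<in> {1..n}} = (\<lambda>q. q * f) ` L ` {1..n}" by blast
      assume "f * N ^ t \<in> ideal.span (B1 \<union> {L i * f | i. i \<in> {1..n}})"
      then have "N ^ t \<in> Q"
        unfolding set_eq
        by (rule cofactor_in_ideal[OF Q(1), rotated 2]) (use Q(4) M(2) assms(7) in \<open>auto simp: L_def\<close>)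
      then have "N \<in> Q" by (rule prime_power[OF Q(1) prime N])
      with NQ show False ..
    qed
    with gen reg N M(1) have "?P L N" unfolding imL by (simp add: L_def)
    then show ?thesis by blast
  qed
  ultimately show ?thesis using inessential by blast
qed

end
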